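(* Let $A$ be an open parity game and $i$ an entrance of $A$. Then $$\mathrm{PF}(A,i)=\max\Big\{\min\big\{[\![\mathrm{play}(\sigma_\exists,\sigma_\forall,i)]\!] : \sigma_\forall \text{ a positional } \forall\text{-strategy}\big\} : \sigma_\exists \text{ a positional } \exists\text{-strategy}\Big\},$$ i.e. positional strategies suffice to determine the Pareto front.
   Context: Fix priorities $\mathbb{P}=\{0,1,\dots,M\}$ with $M\ge 2$ even. A parity game is $G=(V,V_\exists,V_\forall,E,\Omega)$ with $V$ a nonempty finite set of nodes, $(V_\exists,V_\forall)$ a partition of $V$ (nodes owned by Players $\exists$ and $\forall$), $E\subseteq V\times V$ such that every node has a successor, and $\Omega\colon E\to\mathbb{P}$. A play is an infinite path $(v_j)_{j\ge 1}$ along edges; it satisfies the parity condition if the largest priority occurring infinitely often on its edges is even. An $\exists$-strategy is a map $\sigma_\exists\colon V^*V_\exists\to V$ with $(v_n,\sigma_\exists(v_1\cdots v_n))\in E$; $\forall$-strategies are defined analogously on $V^*V_\forall$; a strategy is positional if its value depends only on the last node. $\mathrm{play}(\sigma_\exists,\sigma_\forall,v)$ denotes the unique play from $v$ induced by the two strategies. An open parity game (oPG) $A$ is a parity game together with pairwise disjoint, totally ordered sets $I_r,I_l,O_r,O_l\subseteq V_\exists$; entrances are $I=I_r\cup I_l$, exits are $O=O_r\cup O_l$, and every exit $o$ is a sink whose only outgoing edge is $(o,o)$ with $\Omega(o,o)=0$. The domain is $D(A)=\{\bot,\top\}\cup(O\times\mathbb{P})$. The denotation $[\![p]\!]\in D(A)$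 of a play $p=(v_j)_j$ is: $\top$ if $p$ visits no exit and satisfies the parity condition; $(o,m)$ if $p$ visits an exit $o$, where $j$ is the first index with $v_j=o$ and $m=\max\{\Omega(v_k,v_{k+1}):1\le k\le j-1\}$; $\bot$ if $p$ visits no exit and violates the parity condition. The sub-priority order $\preceq_{\mathbb P}$ is the total order $M-1\prec M-3\prec\cdots\prec 1\prec 0\prec 2\prec\cdots\prec M-2\prec M$. The domain order $\preceq_D$ on $D(A)$: $d_1\preceq_D d_2$ iff $d_1=\bot$, or $d_2=\top$, or $d_1=(o,m_1)$, $d_2=(o,m_2)$ with the same exit $o$ and $m_1\preceq_{\mathbb P}m_2$. For $T\subseteq D(A)$, $\min T$ is the set of $\preceq_D$-minimal elements of $T$. The upper preorder on subsets of $D(A)$: $T_1\preceq_U T_2$ iff for every $d_2\in T_2$ there is $d_1\in T_1$ with $d_1\preceq_D d_2$. For a set $S$ of subsets of $D(A)$, $\max S$ is the set of $\preceq_U$-maximal elements of $S$. For an entrance $i$, the Pareto front is $\mathrm{PF}(A,i)=\max\{\min\{[\![\mathrm{play}(\sigma_\exists,\sigma_\forall,i)]\!]:\sigma_\forall\text{ a }\forall\text{-strategy}\}:\sigma_\exists\text{ an }\exists\text{-strategy}\}$, where strategies are arbitrary (not necessarily positional). *)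

theory Defs
  imports Main
begin

record 'v parity_game =
  nodes :: "'v set"
  ex_nodes :: "'v set"
  all_nodes :: "'v set"
  edges :: "('v \<times> 'v) set"
  prio :: "'v \<times> 'v \<Rightarrow> nat"

text \<open>
  The priorities are \<open>{0..M}\<close>; the values of \<open>prio\<close> outside \<open>edges\<close> are irrelevant.
\<close>

definition parity_game :: "nat \<Rightarrow> ('v, 'x) parity_game_scheme \<Rightarrow> bool" where
  "parity_game M G \<longleftrightarrow>
     finite (nodes G) \<and> nodes G \<noteq> {} \<and>
     ex_nodes G \<union> all_nodes G = nodes G \<and> ex_nodes G \<inter> all_nodes G = {} \<and>
     edges G \<subseteq> nodes G \<times> nodes G \<and>
     (\<forall>v\<in>nodes G. \<exists>w. (v, w) \<in> edges G) \<and>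
     prio G ` edges G \<subseteq> {0..M}"

text \<open>Plays and other sequences of nodes are indexed from \<open>0\<close>.\<close>

definition parity_condition :: "('v, 'x) parity_game_scheme \<Rightarrow> (nat \<Rightarrow> 'v) \<Rightarrow> bool" where
  "parity_condition G p \<longleftrightarrow> even (Max {m. infinite {k. prio G (p k, p (Suc k)) = m}})"

text \<open>
  A strategy of the player owning \<open>U\<close> is a map on \<open>V\<^sup>*U\<close>, rendered as a total function on
  lists whose values outside \<open>V\<^sup>*U\<close> are never used.
\<close>

definition strategy ::
    "('v, 'x) parity_game_scheme \<Rightarrow> 'v set \<Rightarrow> ('v list \<Rightarrow> 'v) \<Rightarrow> bool" where
  "strategy G U \<sigma> \<longleftrightarrow> (\<forall>h\<in>lists (nodes G). \<forall>v\<in>U. (v, \<sigma> (h @ [v])) \<in> edges G)"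

definition positional ::
    "('v, 'x) parity_game_scheme \<Rightarrow> 'v set \<Rightarrow> ('v list \<Rightarrow> 'v) \<Rightarrow> bool" where
  "positional G U \<sigma> \<longleftrightarrow>
     (\<forall>h\<in>lists (nodes G). \<forall>h'\<in>lists (nodes G). \<forall>v\<in>U. \<sigma> (h @ [v]) = \<sigma> (h' @ [v]))"

abbreviation ex_strategy :: "('v, 'x) parity_game_scheme \<Rightarrow> ('v list \<Rightarrow> 'v) \<Rightarrow> bool" where
  "ex_strategy G \<equiv> strategy G (ex_nodes G)"

abbreviation all_strategy :: "('v, 'x) parity_game_scheme \<Rightarrow> ('v list \<Rightarrow> 'v) \<Rightarrow> bool" where
  "all_strategy G \<equiv> strategy G (all_nodes G)"

abbreviation positional_ex_strategy ::
    "('v, 'x) parity_game_scheme \<Rightarrow> ('v list \<Rightarrow> 'v) \<Rightarrow> bool" where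
  "positional_ex_strategy G \<sigma> \<equiv> ex_strategy G \<sigma> \<and> positional G (ex_nodes G) \<sigma>"

abbreviation positional_all_strategy ::
    "('v, 'x) parity_game_scheme \<Rightarrow> ('v list \<Rightarrow> 'v) \<Rightarrow> bool" where
  "positional_all_strategy G \<sigma> \<equiv> all_strategy G \<sigma> \<and> positional G (all_nodes G) \<sigma>"

text \<open>
  \<open>history G \<sigma>\<^sub>E \<sigma>\<^sub>A v n\<close> consists of the first \<open>n + 1\<close> nodes of the play from \<open>v\<close>.
\<close>

primrec history ::
    "('v, 'x) parity_game_scheme \<Rightarrow> ('v list \<Rightarrow> 'v) \<Rightarrow> ('v list \<Rightarrow> 'v) \<Rightarrow> 'v \<Rightarrow> nat \<Rightarrow> 'v list"
  where
    "history G \<sigma>\<^sub>E \<sigma>\<^sub>A v 0 = [v]"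
  | "history G \<sigma>\<^sub>E \<sigma>\<^sub>A v (Suc n) =
       (let h = history G \<sigma>\<^sub>E \<sigma>\<^sub>A v n
        in h @ [if last h \<in> ex_nodes G then \<sigma>\<^sub>E h else \<sigma>\<^sub>A h])"

definition play ::
    "('v, 'x) parity_game_scheme \<Rightarrow> ('v list \<Rightarrow> 'v) \<Rightarrow> ('v list \<Rightarrow> 'v) \<Rightarrow> 'v \<Rightarrow> nat \<Rightarrow> 'v" where
  "play G \<sigma>\<^sub>E \<sigma>\<^sub>A v n = last (history G \<sigma>\<^sub>E \<sigma>\<^sub>A v n)"

text \<open>
  The finite totally ordered sets of entrances and exits are given by their increasing
  enumerations, i.e. by distinct lists.
\<close>

record 'v open_parity_game = "'v parity_game" +
  entr_r :: "'v list"
  entr_l :: "'v list"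
  exit_r :: "'v list"
  exit_l :: "'v list"

definition entrances :: "('v, 'x) open_parity_game_scheme \<Rightarrow> 'v set" where
  "entrances A = set (entr_r A) \<union> set (entr_l A)"

definition exits :: "('v, 'x) open_parity_game_scheme \<Rightarrow> 'v set" where
  "exits A = set (exit_r A) \<union> set (exit_l A)"

text \<open>
  Distinctness of the concatenation expresses both that each list is distinct and that the
  four sets are pairwise disjoint.
\<close>

definition open_parity_game :: "nat \<Rightarrow> ('v, 'x) open_parity_game_scheme \<Rightarrow> bool" where
  "open_parity_game M A \<longleftrightarrow>
     parity_game M A \<and>
     distinct (entr_r A @ entr_l A @ exit_r A @ exit_l A) \<and>
     entrances A \<union> exits A \<subseteq> ex_nodes A \<and>
     (\<forall>x\<in>exits A. {w. (x, w) \<in> edges A} = {x} \<and> prio A (x, x) = 0)"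

text \<open>
  The domain \<open>D(A)\<close> consists of \<open>Bot\<close>, \<open>Top\<close> and those \<open>Exit x m\<close> with \<open>x\<close> an exit of \<open>A\<close> and
  \<open>m \<le> M\<close>. The denotation of a play from a node that is not an exit always lies in \<open>D(A)\<close>.
\<close>

datatype 'v dom = Bot | Top | Exit 'v nat

definition denotation :: "('v, 'x) open_parity_game_scheme \<Rightarrow> (nat \<Rightarrow> 'v) \<Rightarrow> 'v dom" where
  "denotation A p =
     (if \<exists>j. p j \<in> exits A
      then let j = (LEAST j. p j \<in> exits A)
           in Exit (p j) (Max {prio A (p k, p (Suc k)) | k. k < j})
      else if parity_condition A p then Top else Bot)"

text \<open>
  The key orders \<open>{0..M}\<close>, for even \<open>M\<close>, as \<open>M - 1, M - 3, \<dots>, 1, 0, 2, \<dots>, M - 2, M\<close>.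
\<close>

definition sub_prio_key :: "nat \<Rightarrow> int" where
  "sub_prio_key m = (if even m then int m else - int m)"

definition sub_prio_le :: "nat \<Rightarrow> nat \<Rightarrow> bool" where
  "sub_prio_le m n \<longleftrightarrow> sub_prio_key m \<le> sub_prio_key n"

definition dom_le :: "'v dom \<Rightarrow> 'v dom \<Rightarrow> bool" where
  "dom_le d d' \<longleftrightarrow>
     d = Bot \<or> d' = Top \<or> (\<exists>x m m'. d = Exit x m \<and> d' = Exit x m' \<and> sub_prio_le m m')"

definition upper_le :: "'v dom set \<Rightarrow> 'v dom set \<Rightarrow> bool" where
  "upper_le T T' \<longleftrightarrow> (\<forall>d'\<in>T'. \<exists>d\<in>T. dom_le d d')"

definition minimals :: "'v dom set \<Rightarrow> 'v dom set" where
  "minimals T = {d \<in> T. \<forall>d'\<in>T. dom_le d' d \<longrightarrow> dom_le d d'}"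

definition maximals :: "'v dom set set \<Rightarrow> 'v dom set set" where
  "maximals S = {T \<in> S. \<forall>T'\<in>S. upper_le T T' \<longrightarrow> upper_le T' T}"

definition pareto_front :: "('v, 'x) open_parity_game_scheme \<Rightarrow> 'v \<Rightarrow> 'v dom set set" where
  "pareto_front A i =
     maximals {minimals {denotation A (play A \<sigma>\<^sub>E \<sigma>\<^sub>A i) | \<sigma>\<^sub>A. all_strategy A \<sigma>\<^sub>A}
       | \<sigma>\<^sub>E. ex_strategy A \<sigma>\<^sub>E}"

end

(*
  Only upward closed objectives matter for the Pareto front. Such an objective turns into a
  parity objective on a closed game: every exit leads back to the entrance with a priority that
  makes the round trip even iff the exit was reached with an acceptable priority. Against a
  positional opponent a bad round trip could be repeated forever, so positional determinacy of
  parity games lets a player replace any strategy by a positional one that is at least as good.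
  Applied to \<open>\<exists>\<close> this gives cofinal positional \<open>\<exists>\<close>-strategies; applied to \<open>\<forall>\<close> in the graph left
  by a positional \<open>\<exists>\<close>-strategy, it gives the same minimal denotations.
*)

theory Submission
  imports Defs "HOL-Library.Infinite_Set"
begin

section \<open>The parity of a path\<close>

text \<open>An upward closed set of denotations may demand a different threshold at each exit, and
  these demands are incomparable, so no single value can be optimised. One return priority per exit
  expresses them all: for varying \<open>r\<close>, the sets of priorities \<open>m\<close> with
  \<open>max m r\<close> even are exactly the upward closed sets of the sub-priority order. That
  order ranks a priority by its use before an unknown continuation. The two applications are not
  symmetric. For \<exists> one positional strategy must meet the upward closure of everything the
  old strategy admits. For \<forall> each denotation is treated on its own, with a reply that may
  depend on it, since only minimal elements are kept. Determinacy is proved without attractors. The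
  difficulty is that splitting a choice of one player gives the other a strategy with memory; this
  is repaired by splitting on both sides.\<close>

definition path :: "('v \<times> 'v) set \<Rightarrow> (nat \<Rightarrow> 'v) \<Rightarrow> bool" where
  "path E p \<longleftrightarrow> (\<forall>k. (p k, p (Suc k)) \<in> E)"

definition limsup_even :: "('v \<times> 'v \<Rightarrow> nat) \<Rightarrow> (nat \<Rightarrow> 'v) \<Rightarrow> bool" where
  "limsup_even c p \<longleftrightarrow> even (Max {m. infinite {k. c (p k, p (Suc k)) = m}})"

lemma path_mono: "path F p \<Longrightarrow> F \<subseteq> E \<Longrightarrow> path E p"
  by (auto simp: path_def)

text \<open>The eventual bound also makes the set of recurring values finite, so that
  \<open>Max\<close> has its intended meaning.\<close>

lemma limsup_evenI:
  fixes m :: nat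
  assumes le: "\<And>k. k \<ge> N \<Longrightarrow> c (p k, p (Suc k)) \<le> m"
    and inf: "\<And>n. \<exists>k\<ge>n. c (p k, p (Suc k)) = m"
  shows "limsup_even c p \<longleftrightarrow> even m"
proof -
  let ?I = "{m. infinite {k. c (p k, p (Suc k)) = m}}"
  have m: "m \<in> ?I"
    using inf by (auto simp: infinite_nat_iff_unbounded_le)
  have ub: "m' \<le> m" if "m' \<in> ?I" for m'
  proof -
    have "\<exists>k\<ge>N. c (p k, p (Suc k)) = m'"
      using that by (simp add: infinite_nat_iff_unbounded_le)
    then show ?thesis using le by blast
  qed
  then have "finite ?I"
    by (meson atMost_iff finite_atMost finite_subset subsetI)
  then have "Max ?I = m"
    using m ub by (intro Max_eqI) auto
  then show ?thesis by (simp add: limsup_even_def)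
qed

text \<open>Finitely many edges carry finitely many priorities. By pigeonhole some value recurs, and
  infinitely many positions above the largest recurring value would make a larger one recur.\<close>

lemma path_limsup:
  fixes c :: "'v \<times> 'v \<Rightarrow> nat"
  assumes "finite E" "path E p"
  obtains m N where "\<And>k. k \<ge> N \<Longrightarrow> c (p k, p (Suc k)) \<le> m"
    and "\<And>n. \<exists>k\<ge>n. c (p k, p (Suc k)) = m"
proof -
  let ?f = "\<lambda>k. c (p k, p (Suc k))"
  let ?I = "{m. infinite {k. ?f k = m}}"
  have ran: "range ?f \<subseteq> c ` E"
    using assms by (auto simp: path_def)
  then have fin: "finite (range ?f)"
    using assms(1) finite_surj by blast
  have sub: "?I \<subseteq> range ?f"
  proof
    fix m assume "m \<in> ?I"
    then have "{k. ?f k = m} \<noteq> {}" by force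
    then show "m \<in> range ?f" by blast
  qed
  then have finI: "finite ?I" using fin finite_subset by blast
  obtain m0 where "infinite {k. ?f k = m0}"
    using pigeonhole_infinite[of UNIV ?f] fin by auto
  then have ne: "?I \<noteq> {}" by blast
  let ?m = "Max ?I"
  have 1: "infinite {k. ?f k = ?m}"
    using Max_in[OF finI ne] by simp
  have "finite {k. ?f k > ?m}"
  proof (rule ccontr)
    assume inf: "infinite {k. ?f k > ?m}"
    have "finite (?f ` {k. ?f k > ?m})" using fin by (rule rev_finite_subset) blast
    then obtain k0 where k0: "?f k0 > ?m" "infinite {k \<in> {k. ?f k > ?m}. ?f k = ?f k0}"
      using pigeonhole_infinite[OF inf, of ?f] by blast
    have "infinite {k. ?f k = ?f k0}"
      using k0(2) by (rule contrapos_nn) (auto elim: rev_finite_subset)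
    then have "?f k0 \<le> ?m" using finI by simp
    with k0(1) show False by simp
  qed
  then obtain N where "\<forall>k\<in>{k. ?f k > ?m}. k < N"
    using finite_nat_set_iff_bounded by blast
  then have "\<And>k. k \<ge> N \<Longrightarrow> ?f k \<le> ?m"
    by (metis (mono_tags, lifting) leD leI mem_Collect_eq)
  then show thesis
    using that[of N ?m] 1 by (auto simp: infinite_nat_iff_unbounded_le)
qed

lemma limsup_even_shift:
  assumes "finite E" "path E p"
  shows "limsup_even c (\<lambda>k. p (n + k)) \<longleftrightarrow> limsup_even c p"
proof -
  obtain m N where le: "\<And>k. k \<ge> N \<Longrightarrow> c (p k, p (Suc k)) \<le> m"
    and inf: "\<And>n. \<exists>k\<ge>n. c (p k, p (Suc k)) = m"
    using path_limsup[OF assms, of c] by metis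
  have "limsup_even c p \<longleftrightarrow> even m"
    using limsup_evenI[where p=p, OF le inf] by simp
  moreover have "\<exists>k\<ge>a. c (p (n + k), p (n + Suc k)) = m" for a
  proof -
    obtain k where "k \<ge> n + a" "c (p k, p (Suc k)) = m" using inf by blast
    then show ?thesis by (intro exI[of _ "k - n"]) auto
  qed
  then have "limsup_even c (\<lambda>k. p (n + k)) \<longleftrightarrow> even m"
    using le by (intro limsup_evenI[where N=N]) auto
  ultimately show ?thesis by simp
qed

text \<open>Unrolling a closed walk is how a condition on infinite paths is brought to bear on a
  finite segment: the largest priority of the segment decides.\<close>

lemma limsup_even_closed_walk:
  assumes F: "\<And>k. k < l \<Longrightarrow> (q k, q (Suc k)) \<in> F" and l: "l > 0" and cl: "q l = q 0"
    and le: "\<And>k. k < l \<Longrightarrow> c (q k, q (Suc k)) \<le> m"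
    and n: "n < l" "c (q n, q (Suc n)) = m"
  defines "p \<equiv> \<lambda>k. q (k mod l)"
  shows "path F p" "p 0 = q 0" "limsup_even c p \<longleftrightarrow> even m"
proof -
  have step: "p k = q (k mod l) \<and> p (Suc k) = q (Suc (k mod l))" for k
    using cl l by (auto simp: p_def mod_Suc)
  show "path F p" unfolding path_def using step F l by (metis mod_less_divisor)
  show "p 0 = q 0" by (simp add: p_def)
  show "limsup_even c p \<longleftrightarrow> even m"
  proof (rule limsup_evenI[where N=0])
    show "c (p k, p (Suc k)) \<le> m" for k
      using step le l by (metis mod_less_divisor)
    show "\<exists>k\<ge>a. c (p k, p (Suc k)) = m" for a
    proof (intro exI[of _ "a * l + n"] conjI)
      show "a \<le> a * l + n" using l by (simp add: trans_le_add1)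
      show "c (p (a * l + n), p (Suc (a * l + n))) = m"
        using step[of "a * l + n"] n by simp
    qed
  qed
qed

section \<open>Positional determinacy\<close>

text \<open>
  A positional strategy of the player owning \<open>U\<close> is rendered as the set of edges that it leaves,
  so that strategies and subgames are the same kind of object. It may leave the owner a choice.
\<close>

definition restricts :: "'v set \<Rightarrow> ('v \<times> 'v) set \<Rightarrow> ('v \<times> 'v) set \<Rightarrow> bool" where
  "restricts U E F \<longleftrightarrow>
     F \<subseteq> E \<and> Domain F = Domain E \<and> (\<forall>x y. (x, y) \<in> E \<longrightarrow> x \<notin> U \<longrightarrow> (x, y) \<in> F)"

text \<open>\<open>b\<close> is the parity that the owner of \<open>U\<close> wants. One notion thus
  serves both players, who are exchanged by passing to \<open>-U\<close> and
  \<open>\<not> b\<close>.\<close>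

definition pos_wins ::
    "('v \<times> 'v \<Rightarrow> nat) \<Rightarrow> 'v set \<Rightarrow> bool \<Rightarrow> ('v \<times> 'v) set \<Rightarrow> 'v \<Rightarrow> bool" where
  "pos_wins c U b E u \<longleftrightarrow>
     (\<exists>F. restricts U E F \<and> (\<forall>p. p 0 = u \<longrightarrow> path F p \<longrightarrow> limsup_even c p = b))"

text \<open>Winning with memory is only an intermediate notion, for the player against whom a choice
  has been split. Legal moves at every history let two such strategies be played against each
  other.\<close>

definition wins ::
    "('v \<times> 'v \<Rightarrow> nat) \<Rightarrow> 'v set \<Rightarrow> bool \<Rightarrow> ('v \<times> 'v) set \<Rightarrow> 'v \<Rightarrow> bool" where
  "wins c U b E u \<longleftrightarrow>
     (\<exists>s. (\<forall>h x. x \<in> U \<longrightarrow> x \<in> Domain E \<longrightarrow> (x, s (h @ [x])) \<in> E) \<and>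
       (\<forall>p. p 0 = u \<longrightarrow> path E p \<longrightarrow> (\<forall>k. p k \<in> U \<longrightarrow> p (Suc k) = s (map p [0..<Suc k])) \<longrightarrow>
         limsup_even c p = b))"

lemma restricts_trans: "restricts U E F \<Longrightarrow> restricts U F F' \<Longrightarrow> restricts U E F'"
  unfolding restricts_def by blast

lemma pos_wins_restricts: "restricts U E F \<Longrightarrow> pos_wins c U b F u \<Longrightarrow> pos_wins c U b E u"
  unfolding pos_wins_def by (blast intro: restricts_trans)

section \<open>Plays, paths and the two notions of winning\<close>

lemma history_eq_map_play:
  "history G s t v n = map (play G s t v) [0..<Suc n]"
proof (induction n)
  case (Suc n)
  have "history G s t v (Suc n) = history G s t v n @ [play G s t v (Suc n)]"
    by (simp add: play_def Let_def)
  also have "\<dots> = map (play G s t v) [0..<Suc n] @ [play G s t v (Suc n)]"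
    by (simp only: Suc.IH)
  finally show ?case by simp
qed (simp add: play_def)

lemma play_0: "play G s t v 0 = v"
  by (simp add: play_def)

lemma play_Suc:
  "play G s t v (Suc n) =
     (if play G s t v n \<in> ex_nodes G then s (map (play G s t v) [0..<Suc n])
      else t (map (play G s t v) [0..<Suc n]))"
proof -
  have "play G s t v (Suc n) =
     (if play G s t v n \<in> ex_nodes G then s (history G s t v n) else t (history G s t v n))"
    unfolding play_def by (simp add: Let_def)
  then show ?thesis by (simp only: history_eq_map_play)
qed

lemma exists_play:
  obtains p where "p 0 = u" "\<And>k. p (Suc k) = g (map p [0..<Suc k])"
proof
  \<comment> \<open>With \<open>g\<close> on both sides the owner of a node makes no difference, so
    any game yields the recursion along histories.\<close>
  let ?p = "play (undefined :: 'a parity_game) g g u"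
  show "?p 0 = u" by (rule play_0)
  show "?p (Suc k) = g (map ?p [0..<Suc k])" for k
    by (subst play_Suc) (rule if_cancel)
qed

lemma exists_path:
  assumes "Range F \<subseteq> Domain F" "u \<in> Domain F"
  obtains p where "p 0 = u" "path F p"
proof -
  obtain p where p: "p 0 = u" "\<And>k. p (Suc k) = (SOME y. (last (map p [0..<Suc k]), y) \<in> F)"
    using exists_play[of u "\<lambda>h. SOME y. (last h, y) \<in> F"] by blast
  have some: "(x, SOME y. (x, y) \<in> F) \<in> F" if "x \<in> Domain F" for x
    using that by (auto intro: someI)
  have "p k \<in> Domain F" for k
  proof (induction k)
    case (Suc k)
    then show ?case using some[of "p k"] p(2)[of k] assms(1) by auto
  qed (simp add: p assms)
  then have "path F p"
    unfolding path_def using p(2) some by simp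
  with p(1) show thesis using that by blast
qed

text \<open>At each node one of the two sets keeps every edge of \<open>E\<close>, so the
  intersection keeps all that the other one leaves.\<close>

lemma restricts_Int_total:
  assumes "restricts U E F" "restricts (-U) E F'" "Range E \<subseteq> Domain E"
  shows "Domain (F \<inter> F') = Domain E" "Range (F \<inter> F') \<subseteq> Domain (F \<inter> F')"
proof -
  show 1: "Domain (F \<inter> F') = Domain E"
    using assms(1,2) unfolding restricts_def by blast
  have "Range (F \<inter> F') \<subseteq> Range E"
    using assms(1) unfolding restricts_def by blast
  then show "Range (F \<inter> F') \<subseteq> Domain (F \<inter> F')"
    unfolding 1 using assms(3) by (rule subset_trans)
qed

lemma pos_wins_imp_wins:
  assumes "pos_wins c U b E u"
  shows "wins c U b E u"
proof -
  obtain F where F: "restricts U E F" "\<And>p. p 0 = u \<Longrightarrow> path F p \<Longrightarrow> limsup_even c p = b"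
    using assms unfolding pos_wins_def by blast
  let ?s = "\<lambda>h. SOME y. (last h, y) \<in> F"
  have some: "(x, SOME y. (x, y) \<in> F) \<in> F" if "x \<in> Domain E" for x
    using that F(1) unfolding restricts_def by (auto intro: someI)
  show ?thesis unfolding wins_def
  proof (intro exI[of _ ?s] conjI allI impI)
    show "(x, ?s (h @ [x])) \<in> E" if "x \<in> Domain E" for h x
      using some[OF that] F(1) unfolding restricts_def by auto
    fix p assume p: "p 0 = u" "path E p" "\<forall>k. p k \<in> U \<longrightarrow> p (Suc k) = ?s (map p [0..<Suc k])"
    have "(p k, p (Suc k)) \<in> F" for k
    proof (cases "p k \<in> U")
      case True
      then show ?thesis using p some[of "p k"] unfolding path_def by auto
    next
      case False
      then show ?thesis using p F(1) unfolding path_def restricts_def by auto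
    qed
    then show "limsup_even c p = b" using F(2) p(1) by (simp add: path_def)
  qed
qed

lemma wins_exclusive:
  assumes "wins c U b E u" "wins c (-U) (\<not> b) E u" "Range E \<subseteq> Domain E" "u \<in> Domain E"
  shows False
proof -
  obtain s where s: "\<And>h x. x \<in> U \<Longrightarrow> x \<in> Domain E \<Longrightarrow> (x, s (h @ [x])) \<in> E"
    "\<And>p. p 0 = u \<Longrightarrow> path E p \<Longrightarrow> (\<And>k. p k \<in> U \<Longrightarrow> p (Suc k) = s (map p [0..<Suc k]))
       \<Longrightarrow> limsup_even c p = b"
    using assms(1) unfolding wins_def by blast
  obtain t where t: "\<And>h x. x \<in> -U \<Longrightarrow> x \<in> Domain E \<Longrightarrow> (x, t (h @ [x])) \<in> E"
    "\<And>p. p 0 = u \<Longrightarrow> path E p \<Longrightarrow> (\<And>k. p k \<in> -U \<Longrightarrow> p (Suc k) = t (map p [0..<Suc k]))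
       \<Longrightarrow> limsup_even c p = (\<not> b)"
    using assms(2) unfolding wins_def by blast
  obtain p where p: "p 0 = u"
    "\<And>k. p (Suc k) = (if last (map p [0..<Suc k]) \<in> U then s (map p [0..<Suc k])
                        else t (map p [0..<Suc k]))"
    using exists_play[of u "\<lambda>h. if last h \<in> U then s h else t h"] by blast
  have step: "(p k, p (Suc k)) \<in> E" if "p k \<in> Domain E" for k
    using p(2)[of k] s(1)[of "p k" "map p [0..<k]"] t(1)[of "p k" "map p [0..<k]"] that
    by (auto split: if_splits)
  have "p k \<in> Domain E" for k
  proof (induction k)
    case (Suc k)
    then show ?case using step[of k] assms(3) by auto
  qed (simp add: p assms)
  then have pa: "path E p" using step by (simp add: path_def)
  have "limsup_even c p = b"
    using p pa by (intro s(2)) auto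
  moreover have "limsup_even c p = (\<not> b)"
    using p pa by (intro t(2)) auto
  ultimately show False by simp
qed

text \<open>
  The combined strategy of the opponent: before \<open>v\<close> is reached follow \<open>F 0\<close>, and after each visit
  of \<open>v\<close> follow the one of \<open>F 1\<close> and \<open>F 2\<close> to which the edge taken at \<open>v\<close> belongs. If \<open>v\<close> recurs,
  the dominating priority occurs on a closed walk through \<open>v\<close> inside a single \<open>F j\<close>, and repeating
  this walk gives a path in \<open>F j\<close> with the same parity.
\<close>

lemma limsup_even_switching:
  fixes m :: "nat \<Rightarrow> nat"
  assumes fin: "\<And>j. finite (F j)" "finite E" "path E p"
    and u: "p 0 = u" "m 0 = 0"
    and step: "\<And>k. (p k, p (Suc k)) \<in> F (m (Suc k))"
    and stay: "\<And>k. p k \<noteq> v \<Longrightarrow> m (Suc k) = m k"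
    and switch: "\<And>k. p k = v \<Longrightarrow> m (Suc k) \<noteq> 0"
    and win0: "\<And>q. q 0 = u \<Longrightarrow> path (F 0) q \<Longrightarrow> limsup_even c q = b"
    and win: "\<And>j q. j \<noteq> 0 \<Longrightarrow> q 0 = v \<Longrightarrow> path (F j) q \<Longrightarrow> limsup_even c q = b"
  shows "limsup_even c p = b"
proof -
  have const: "m (Suc a + j) = m (Suc a)" if "\<And>k. a < k \<Longrightarrow> k \<le> a + j \<Longrightarrow> p k \<noteq> v" for a j
    using that
  proof (induction j)
    case (Suc j)
    then show ?case using stay[of "Suc a + j"] by simp
  qed simp
  show ?thesis
  proof (cases "finite {k. p k = v}")
    case True
    show ?thesis
    proof (cases "{k. p k = v} = {}")
      case True
      then have "m k = 0" for k by (induction k) (use u stay in auto)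
      then show ?thesis using win0[of p] u step by (simp add: path_def)
    next
      case False
      define a where "a = Max {k. p k = v}"
      have a: "p a = v" using Max_in[OF True False] by (simp add: a_def)
      have after: "p k \<noteq> v" if "a < k" for k
        using Max_ge[OF True, of k] that by (auto simp: a_def)
      have "m (Suc a + j) = m (Suc a)" for j
        using after by (intro const) auto
      then have "path (F (m (Suc a))) (\<lambda>k. p (a + k))"
        using step[of "a + _"] by (simp add: path_def)
      then have "limsup_even c (\<lambda>k. p (a + k)) = b"
        using win[of "m (Suc a)"] switch[of a] a by simp
      then show ?thesis using limsup_even_shift[OF fin(2,3)] by simp
    qed
  next
    case False
    obtain M N where le: "\<And>k. k \<ge> N \<Longrightarrow> c (p k, p (Suc k)) \<le> M"
      and inf: "\<And>n. \<exists>k\<ge>n. c (p k, p (Suc k)) = M"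
      using path_limsup[OF fin(2,3), of c] by metis
    obtain k0 where k0: "k0 \<ge> N" "p k0 = v"
      using False by (auto simp: infinite_nat_iff_unbounded_le)
    obtain n where n: "n \<ge> k0" "c (p n, p (Suc n)) = M"
      using inf by blast
    \<comment> \<open>The last visit of \<open>v\<close> up to \<open>n\<close> and, as
      \<open>e\<close>, the next one after \<open>n\<close>: between them the index cannot change,
      so the segment lies in a single \<open>F j\<close>.\<close>
    define a where "a = (GREATEST k. p k = v \<and> k \<le> n)"
    have a: "p a = v" "a \<le> n" and amax: "\<And>k. p k = v \<Longrightarrow> k \<le> n \<Longrightarrow> k \<le> a"
      using GreatestI_nat[of "\<lambda>k. p k = v \<and> k \<le> n" k0 n]
        Greatest_le_nat[of "\<lambda>k. p k = v \<and> k \<le> n" _ n] k0 n unfolding a_def by auto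
    have "\<exists>k. p k = v \<and> k > n"
      using False by (auto simp: infinite_nat_iff_unbounded)
    define e where "e = (LEAST k. p k = v \<and> k > n)"
    have e: "p e = v" "e > n" and emin: "\<And>k. p k = v \<Longrightarrow> k > n \<Longrightarrow> e \<le> k"
      using LeastI_ex[OF \<open>\<exists>k. p k = v \<and> k > n\<close>] Least_le[of "\<lambda>k. p k = v \<and> k > n"]
      unfolding e_def by auto
    have "a \<ge> N" using amax k0 n by fastforce
    have m: "m (Suc (a + j)) = m (Suc a)" if "j < e - a" for j
    proof -
      have "p k \<noteq> v" if "a < k" "k \<le> a + j" for k
        using amax[of k] emin[of k] that \<open>j < e - a\<close> by force
      then show ?thesis using const[of a j] by simp
    qed
    define q where "q = (\<lambda>k. p (a + k))"
    define p' where "p' = (\<lambda>k. q (k mod (e - a)))"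
    have qF: "(q k, q (Suc k)) \<in> F (m (Suc a))" if "k < e - a" for k
      using step[of "a + k"] m[OF that] by (simp add: q_def)
    have ql: "e - a > 0" "q (e - a) = q 0" "n - a < e - a"
      "c (q (n - a), q (Suc (n - a))) = M"
      using a e n by (auto simp: q_def)
    have qM: "c (q k, q (Suc k)) \<le> M" for k
      using le[of "a + k"] \<open>a \<ge> N\<close> by (simp add: q_def)
    have "path (F (m (Suc a))) p'" "p' 0 = q 0" "limsup_even c p' \<longleftrightarrow> even M"
      using limsup_even_closed_walk[where F="F (m (Suc a))" and q=q and c=c, OF qF ql(1,2) qM ql(3,4)]
      unfolding p'_def by blast+
    then have "b \<longleftrightarrow> even M"
      using win[of "m (Suc a)" p'] switch[of a] a by (simp add: q_def)
    moreover have "limsup_even c p \<longleftrightarrow> even M"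
      using limsup_evenI[where p=p, OF le inf] by simp
    ultimately show ?thesis by simp
  qed
qed

text \<open>
  The history is given latest node first; the value is the index \<open>j\<close> of the \<open>F j\<close> to follow.
\<close>

fun memory :: "'v \<Rightarrow> 'v \<Rightarrow> 'v list \<Rightarrow> nat" where
  "memory v w (y # x # h) = (if x = v then (if y = w then 2 else 1) else memory v w (x # h))"
| "memory v w h = 0"

lemma memory_Suc:
  "memory v w (rev (map p [0..<Suc (Suc k)])) =
     (if p k = v then (if p (Suc k) = w then 2 else 1) else memory v w (rev (map p [0..<Suc k])))"
  by simp

text \<open>At \<open>v\<close> the owner of \<open>U\<close> either gives up the edge to
  \<open>w\<close> (\<open>E1\<close>) or commits to it (\<open>E2\<close>). Without a positional
  win in \<open>E\<close>, the induction hypothesis gives the opponent positional wins from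
  \<open>u\<close> in both games. If the owner wins from \<open>v\<close> in one of them, the
  opponent's win there has to avoid \<open>v\<close> and survives the return of the removed edges.
  Otherwise the opponent wins from \<open>v\<close> in both and can switch between the two
  strategies.\<close>

lemma choice_step:
  assumes fin: "finite E" and tot: "Range E \<subseteq> Domain E" and u: "u \<in> Domain E"
    and v: "v \<in> U" "(v, w) \<in> E" "(v, w') \<in> E" "w \<noteq> w'"
    and IH: "\<And>E' x. E' \<subset> E \<Longrightarrow> Domain E' = Domain E \<Longrightarrow> x \<in> Domain E \<Longrightarrow>
      pos_wins c U b E' x \<or> pos_wins c (-U) (\<not> b) E' x"
  shows "pos_wins c U b E u \<or> wins c (-U) (\<not> b) E u"
proof -
  define E1 where "E1 = E - {(v, w)}"
  define E2 where "E2 = E - {(v, y) | y. y \<noteq> w}"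
  have "x \<in> Domain E1 \<and> x \<in> Domain E2" if "x \<in> Domain E" for x
    using that v(2-4) by (cases "x = v") (auto simp: E1_def E2_def)
  then have dom: "Domain E1 = Domain E" "Domain E2 = Domain E"
    by (auto simp: E1_def E2_def)
  have sub: "E1 \<subset> E" "E2 \<subset> E"
    using v(2-4) unfolding E1_def E2_def by auto
  have restr: "restricts U E E1" "restricts U E E2"
    using dom v(1) unfolding restricts_def by (auto simp: E1_def E2_def)
  have vd: "v \<in> Domain E" using v by blast
  show ?thesis
  proof (cases "pos_wins c U b E u")
    case npos: False
    then have "\<not> pos_wins c U b E1 u"
      using pos_wins_restricts[OF restr(1)] by blast
    then have "pos_wins c (-U) (\<not> b) E1 u"
      using IH[OF sub(1) dom(1) u] by blast
    then obtain F0 where F0: "restricts (-U) E1 F0"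
      "\<And>p. p 0 = u \<Longrightarrow> path F0 p \<Longrightarrow> limsup_even c p = (\<not> b)"
      unfolding pos_wins_def by blast
    obtain G0 where G0: "restricts (-U) E2 G0"
      "\<And>p. p 0 = u \<Longrightarrow> path G0 p \<Longrightarrow> limsup_even c p = (\<not> b)"
      using npos pos_wins_restricts[OF restr(2)] IH[OF sub(2) dom(2) u]
      unfolding pos_wins_def[of _ "-U"] by blast
    have avoid: "wins c (-U) (\<not> b) E u"
      if won: "pos_wins c U b E' v" and E': "E' = E1 \<or> E' = E2"
        and H: "restricts (-U) E' H" "\<And>p. p 0 = u \<Longrightarrow> path H p \<Longrightarrow> limsup_even c p = (\<not> b)"
      for E' H
    proof -
      have dE': "Domain E' = Domain E" and sE': "E' \<subset> E" using E' dom sub by auto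
      have tE': "Range E' \<subseteq> Domain E'" using dE' sE' tot by blast
      obtain F where F: "restricts U E' F" "\<And>p. p 0 = v \<Longrightarrow> path F p \<Longrightarrow> limsup_even c p = b"
        using won unfolding pos_wins_def by blast
      note I = restricts_Int_total[OF F(1) H(1) tE']
      have offv: "(x, y) \<in> E'" if "(x, y) \<in> E" "x \<noteq> v" for x y
        using that E' by (auto simp: E1_def E2_def)
      define H' where "H' = H \<union> {(x, y) \<in> E. x = v}"
      have rH': "restricts (-U) E H'"
        using H(1) dE' sE' offv unfolding restricts_def H'_def by blast
      have "limsup_even c p = (\<not> b)" if p: "p 0 = u" "path H' p" for p
      proof (cases "\<exists>k. p k = v")
        case False
        then have "path H p" using p(2) unfolding path_def H'_def by auto
        then show ?thesis using H(2) p(1) by blast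
      next
        case True
        define n where "n = (LEAST k. p k = v)"
        have n: "p n = v" "\<And>k. k < n \<Longrightarrow> p k \<noteq> v"
          using LeastI_ex[OF True] not_less_Least unfolding n_def by blast+
        obtain q where q: "q 0 = v" "path (F \<inter> H) q"
          using exists_path[OF I(2), of v] I(1) dE' vd by blast
        \<comment> \<open>Up to its first visit of \<open>v\<close> the path \<open>p\<close> stays
          in \<open>H\<close>. Continuing inside \<open>F \<inter> H\<close> gives a path that the
          opponent wins because of \<open>H\<close>, with a tail from \<open>v\<close> that the
          owner wins because of \<open>F\<close>.\<close>
        define r where "r = (\<lambda>k. if k < n then p k else q (k - n))"
        have r0: "r 0 = u" using p n q by (auto simp: r_def)
        have "path H r" unfolding path_def
        proof
          fix k
          consider "Suc k < n" | "Suc k = n" | "k \<ge> n" by linarith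
          then show "(r k, r (Suc k)) \<in> H"
          proof cases
            case 1
            then show ?thesis using n(2)[of k] p(2) by (auto simp: r_def path_def H'_def)
          next
            case 2
            then have "r (Suc k) = p (Suc k)" using q(1) n(1) by (simp add: r_def)
            then show ?thesis using 2 n(2)[of k] p(2) by (auto simp: r_def path_def H'_def)
          next
            case 3
            then show ?thesis using q(2) by (auto simp: r_def path_def Suc_diff_le)
          qed
        qed
        moreover have "finite H"
          using H(1) sE' by (intro finite_subset[OF _ fin]) (auto simp: restricts_def)
        moreover have "(\<lambda>k. r (n + k)) = q" by (auto simp: r_def)
        ultimately have "limsup_even c q = (\<not> b)"
          using limsup_even_shift[of H r c n] H(2)[of r] r0 by simp
        moreover have "limsup_even c q = b"
          using F(2)[of q] q(1) path_mono[OF q(2), of F] by simp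
        ultimately show ?thesis by simp
      qed
      then have "pos_wins c (-U) (\<not> b) E u"
        using rH' unfolding pos_wins_def by blast
      then show ?thesis by (rule pos_wins_imp_wins)
    qed
    have "wins c (-U) (\<not> b) E u"
    proof (cases "pos_wins c U b E1 v \<or> pos_wins c U b E2 v")
      case True
      then show ?thesis using avoid F0 G0 by blast
    next
      case False
      then have "pos_wins c (-U) (\<not> b) E1 v" "pos_wins c (-U) (\<not> b) E2 v"
        using IH[OF sub(1) dom(1) vd] IH[OF sub(2) dom(2) vd] by auto
      then obtain F1 F2 where
        F1: "restricts (-U) E1 F1" "\<And>p. p 0 = v \<Longrightarrow> path F1 p \<Longrightarrow> limsup_even c p = (\<not> b)" and
        F2: "restricts (-U) E2 F2" "\<And>p. p 0 = v \<Longrightarrow> path F2 p \<Longrightarrow> limsup_even c p = (\<not> b)"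
        unfolding pos_wins_def by blast
      \<comment> \<open>\<open>E1\<close> and \<open>E2\<close> differ only at \<open>v\<close>, so
        \<open>F0\<close> is a valid start before \<open>v\<close> is seen. Index 2 belongs to
        \<open>E2\<close>, where \<open>w\<close> is the only successor of \<open>v\<close>.\<close>
      define F where "F = (\<lambda>j::nat. if j = 0 then F0 else if j = 1 then F1 else F2)"
      have FE: "F j \<subseteq> E" "Domain (F j) = Domain E" for j
        using F0(1) F1(1) F2(1) sub dom unfolding F_def restricts_def by auto
      have FU: "(x, y) \<in> F j" if "(x, y) \<in> E" "x \<in> U" "x \<noteq> v" for x y j
        using that F0(1) F1(1) F2(1) unfolding F_def restricts_def E1_def E2_def by auto
      have Fv: "(v, y) \<in> F (if y = w then 2 else 1)" if "(v, y) \<in> E" for y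
        using that v(1) F1(1) F2(1) unfolding F_def restricts_def E1_def E2_def by auto
      let ?s = "\<lambda>h. SOME y. (last h, y) \<in> F (memory v w (rev h))"
      have some: "(x, SOME y. (x, y) \<in> F j) \<in> F j" if "x \<in> Domain E" for x j
        using that FE(2)[of j] by (auto intro: someI)
      show ?thesis unfolding wins_def
      proof (intro exI[of _ ?s] conjI allI impI)
        show "(x, ?s (h @ [x])) \<in> E" if "x \<in> Domain E" for h x
          using some[OF that] FE(1) by auto
        fix p assume p: "p 0 = u" "path E p"
          "\<forall>k. p k \<in> -U \<longrightarrow> p (Suc k) = ?s (map p [0..<Suc k])"
        \<comment> \<open>\<open>m k\<close> depends on the edges taken before position
          \<open>k\<close>. An edge leaving \<open>v\<close> counts only from
          \<open>m (Suc k)\<close> on, and this is the index of the set containing the edge from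
          \<open>p k\<close>.\<close>
        define m where "m = (\<lambda>k. memory v w (rev (map p [0..<Suc k])))"
        have mS: "m (Suc k) = (if p k = v then (if p (Suc k) = w then 2 else 1) else m k)" for k
          unfolding m_def by (rule memory_Suc)
        have edge: "(p k, p (Suc k)) \<in> E" for k using p(2) by (simp add: path_def)
        show "limsup_even c p = (\<not> b)"
        proof (rule limsup_even_switching[where F=F and E=E and m=m and v=v and u=u])
          show "finite (F j)" for j using FE(1) fin finite_subset by blast
          show "m 0 = 0" by (simp add: m_def)
          show "(p k, p (Suc k)) \<in> F (m (Suc k))" for k
          proof (cases "p k \<in> U")
            case True
            then show ?thesis
              using FU[OF edge True] Fv edge[of k] by (cases "p k = v") (auto simp: mS)
          next
            case False
            then have "p k \<noteq> v" using v(1) by blast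
            moreover have "p (Suc k) = (SOME y. (p k, y) \<in> F (m k))"
              using p(3) False by (simp add: m_def)
            ultimately show ?thesis using some[of "p k" "m k"] edge[of k] by (auto simp: mS)
          qed
          show "limsup_even c q = (\<not> b)" if "q 0 = u" "path (F 0) q" for q
            using that F0(2) by (simp add: F_def)
          show "limsup_even c q = (\<not> b)" if "j \<noteq> 0" "q 0 = v" "path (F j) q" for j q
            using that F1(2) F2(2) by (auto simp: F_def split: if_splits)
        qed (use p fin mS in auto)
      qed
    qed
    then show ?thesis ..
  qed simp
qed

text \<open>Every path obeys a strategy that never has a choice, so \<open>E\<close> itself is the
  positional strategy.\<close>

lemma single_choice_wins:
  assumes "\<And>x y z. x \<in> U \<Longrightarrow> (x, y) \<in> E \<Longrightarrow> (x, z) \<in> E \<Longrightarrow> y = z" and "wins c U b E u"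
  shows "pos_wins c U b E u"
proof -
  obtain s where s: "\<And>h x. x \<in> U \<Longrightarrow> x \<in> Domain E \<Longrightarrow> (x, s (h @ [x])) \<in> E"
    "\<And>p. p 0 = u \<Longrightarrow> path E p \<Longrightarrow> (\<And>k. p k \<in> U \<Longrightarrow> p (Suc k) = s (map p [0..<Suc k]))
       \<Longrightarrow> limsup_even c p = b"
    using assms(2) unfolding wins_def by blast
  have "limsup_even c p = b" if p: "p 0 = u" "path E p" for p
  proof (rule s(2)[OF p])
    fix k assume k: "p k \<in> U"
    have e: "(p k, p (Suc k)) \<in> E" using p by (simp add: path_def)
    then have "(p k, s (map p [0..<k] @ [p k])) \<in> E" using s(1) k by blast
    then show "p (Suc k) = s (map p [0..<Suc k])" using assms(1)[OF k e] by simp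
  qed
  moreover have "restricts U E E" by (auto simp: restricts_def)
  ultimately show ?thesis unfolding pos_wins_def by blast
qed

text \<open>
  Splitting the choice at a node of one player makes that player positional at the price of one
  bit of memory for the opponent. Doing this for both players makes both positional, because
  they cannot both win.
\<close>

theorem positional_determinacy:
  assumes "finite E" "Range E \<subseteq> Domain E" "u \<in> Domain E"
  shows "pos_wins c U b E u \<or> pos_wins c (-U) (\<not> b) E u"
  using assms
proof (induction "card E" arbitrary: E u rule: less_induct)
  case less
  have IH: "pos_wins c U b E' x \<or> pos_wins c (-U) (\<not> b) E' x"
    if "E' \<subset> E" "Domain E' = Domain E" "x \<in> Domain E" for E' x
  proof (rule less.hyps)
    show "card E' < card E" using psubset_card_mono[OF less.prems(1) that(1)] .
    show "finite E'" using that(1) less.prems(1) finite_subset by blast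
    show "Range E' \<subseteq> Domain E'" using that(1,2) less.prems(2) by blast
    show "x \<in> Domain E'" using that by simp
  qed
  note excl = wins_exclusive[OF _ _ less.prems(2,3), of c U b]
  let ?single = "\<lambda>U. \<forall>x y z. x \<in> U \<longrightarrow> (x, y) \<in> E \<longrightarrow> (x, z) \<in> E \<longrightarrow> y = z"
  have 0: "pos_wins c U b E u \<or> wins c (-U) (\<not> b) E u" if ns: "\<not> ?single U"
  proof -
    obtain v w w' where "v \<in> U" "(v, w) \<in> E" "(v, w') \<in> E" "w \<noteq> w'"
      using ns by blast
    then show ?thesis using IH by (rule choice_step[OF less.prems])
  qed
  have 1: "pos_wins c (-U) (\<not> b) E u \<or> wins c U b E u" if ns: "\<not> ?single (-U)"
  proof -
    obtain v w w' where v: "v \<in> -U" "(v, w) \<in> E" "(v, w') \<in> E" "w \<noteq> w'"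
      using ns by blast
    have "pos_wins c (-U) (\<not> b) E' x \<or> pos_wins c (- (-U)) (\<not> \<not> b) E' x"
      if "E' \<subset> E" "Domain E' = Domain E" "x \<in> Domain E" for E' x
      using IH[OF that] by auto
    then have "pos_wins c (-U) (\<not> b) E u \<or> wins c (- (-U)) (\<not> \<not> b) E u"
      by (rule choice_step[OF less.prems v])
    then show ?thesis by simp
  qed
  show ?case
  proof (cases "?single U")
    case U: True
    show ?thesis
    proof (cases "?single (-U)")
      case False
      then show ?thesis using 1 single_choice_wins U by metis
    next
      case True
      \<comment> \<open>Nobody has a choice: the only path from \<open>u\<close> decides the winner,
        and \<open>E\<close> is a strategy for either player.\<close>
      then have det: "\<And>x y z. (x, y) \<in> E \<Longrightarrow> (x, z) \<in> E \<Longrightarrow> y = z" using U by blast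
      obtain q where q: "q 0 = u" "path E q" using exists_path less.prems by metis
      have "p = q" if p: "p 0 = u" "path E p" for p
      proof
        show "p k = q k" for k
        proof (induction k)
          case (Suc k)
          then show ?case using det p(2) q(2) unfolding path_def by metis
        qed (simp add: p q)
      qed
      moreover have "restricts U' E E" for U' by (auto simp: restricts_def)
      ultimately show ?thesis unfolding pos_wins_def by metis
    qed
  next
    case False
    note U = 0[OF this]
    show ?thesis
    proof (cases "?single (-U)")
      case True
      then show ?thesis using U single_choice_wins[of "-U"] by metis
    next
      case False
      \<comment> \<open>If neither player won positionally, the two splittings would let both win
        with memory.\<close>
      then show ?thesis using U 1 excl by blast
    qed
  qed
qed

section \<open>Positional strategies for monotone objectives\<close>

text \<open>
  Every exit gets an edge back to the entrance. Its priority \<open>r x\<close> answers the priority collected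
  on the way: the round trip is good for \<open>\<exists>\<close> iff the maximum of both is even.
\<close>

definition loop_edges :: "'v set \<Rightarrow> 'v \<Rightarrow> ('v \<times> 'v) set \<Rightarrow> ('v \<times> 'v) set" where
  "loop_edges X i E = {(x, y) \<in> E. x \<notin> X} \<union> X \<times> {i}"

definition loop_prio ::
    "('v, 'x) open_parity_game_scheme \<Rightarrow> ('v \<Rightarrow> nat) \<Rightarrow> 'v \<times> 'v \<Rightarrow> nat" where
  "loop_prio A r e = (if fst e \<in> exits A then r (fst e) else prio A e)"

fun good :: "('v \<Rightarrow> nat) \<Rightarrow> 'v dom \<Rightarrow> bool" where
  "good r Bot = False"
| "good r Top = True"
| "good r (Exit x m) = even (max m (r x))"

lemma denotation_Exit:
  assumes "p j \<in> exits A"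
  obtains n where "p n \<in> exits A" "\<And>k. k < n \<Longrightarrow> p k \<notin> exits A"
    "denotation A p = Exit (p n) (Max ((\<lambda>k. prio A (p k, p (Suc k))) ` {..<n}))"
proof
  let ?n = "LEAST j. p j \<in> exits A"
  show "p ?n \<in> exits A" using assms by (rule LeastI)
  show "p k \<notin> exits A" if "k < ?n" for k using that by (rule not_less_Least)
  have "{prio A (p k, p (Suc k)) | k. k < ?n} = (\<lambda>k. prio A (p k, p (Suc k))) ` {..<?n}" by auto
  then show "denotation A p = Exit (p ?n) (Max ((\<lambda>k. prio A (p k, p (Suc k))) ` {..<?n}))"
    using assms by (auto simp: denotation_def Let_def)
qed

text \<open>\<open>F\<close> is a set of edges without memory, so the return edge closes a path to
  an exit into a walk whose repetition is again a path in \<open>F\<close>. The win in the looped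
  game therefore fixes the parity of one round trip.\<close>

lemma good_denotation:
  assumes win: "\<And>q. q 0 = i \<Longrightarrow> path F q \<Longrightarrow> limsup_even (loop_prio A r) q = b"
    and ret: "exits A \<times> {i} \<subseteq> F" and i: "i \<notin> exits A" "p 0 = i"
    and F: "\<And>k. p k \<notin> exits A \<Longrightarrow> (p k, p (Suc k)) \<in> F"
  shows "good r (denotation A p) = b"
proof (cases "\<exists>j. p j \<in> exits A")
  case False
  then have "limsup_even (loop_prio A r) p = b"
    using F i by (intro win) (auto simp: path_def)
  moreover have "loop_prio A r (p k, p (Suc k)) = prio A (p k, p (Suc k))" for k
    using False by (simp add: loop_prio_def)
  ultimately have "parity_condition A p = b"
    by (simp add: parity_condition_def limsup_even_def)
  then show ?thesis using False by (simp add: denotation_def)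
next
  case True
  then obtain n where n: "p n \<in> exits A" "\<And>k. k < n \<Longrightarrow> p k \<notin> exits A"
    "denotation A p = Exit (p n) (Max ((\<lambda>k. prio A (p k, p (Suc k))) ` {..<n}))"
    using denotation_Exit by blast
  let ?I = "(\<lambda>k. prio A (p k, p (Suc k))) ` {..<n}"
  define m where "m = Max ?I"
  \<comment> \<open>The walk has \<open>Suc n\<close> edges, the last being the return edge, hence
    the value \<open>i\<close> at \<open>Suc n\<close>.\<close>
  define q where "q = (\<lambda>k. if k \<le> n then p k else i)"
  \<comment> \<open>The entrance is not an exit, so \<open>Max\<close> ranges over a nonempty
    set.\<close>
  have "n > 0" using n(1) i by (cases n) auto
  then have ne: "?I \<noteq> {}" by auto
  have edge: "(q k, q (Suc k)) \<in> F" if "k < Suc n" for k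
    using that n(1,2) F ret by (cases "k = n") (auto simp: q_def)
  have pr: "loop_prio A r (q k, q (Suc k)) = (if k = n then r (p n) else prio A (p k, p (Suc k)))"
    if "k < Suc n" for k
    using that n(1,2) by (auto simp: q_def loop_prio_def)
  have le: "loop_prio A r (q k, q (Suc k)) \<le> max m (r (p n))" if "k < Suc n" for k
  proof (cases "k = n")
    case False
    then have "prio A (p k, p (Suc k)) \<le> m"
      unfolding m_def using that by (intro Max_ge) auto
    then show ?thesis using pr[OF that] False by simp
  qed (simp add: pr)
  obtain k where k: "k < Suc n" "loop_prio A r (q k, q (Suc k)) = max m (r (p n))"
  proof (cases "m \<le> r (p n)")
    case True
    then show ?thesis using pr[of n] by (intro that[of n]) auto
  next
    case False
    obtain k where "k < n" "prio A (p k, p (Suc k)) = m"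
      using Max_in[OF _ ne] unfolding m_def by auto
    then show ?thesis using pr[of k] False by (intro that[of k]) auto
  qed
  have q: "Suc n > 0" "q (Suc n) = q 0" using i by (auto simp: q_def)
  note W = limsup_even_closed_walk[where F=F and q=q and c="loop_prio A r", OF edge q le k]
  have "b \<longleftrightarrow> even (max m (r (p n)))"
    using win[OF _ W(1)] W(2,3) i by (simp add: q_def)
  then show ?thesis using n(3) by (simp add: m_def)
qed

text \<open>\<open>reach\<close> grants only one path of the right outcome against each positional
  opponent, and the path may change with the opponent. This refutes a positional win of the opponent
  in the looped game, and determinacy turns that into a single positional \<open>f\<close>.\<close>

lemma positional_good:
  fixes A :: "('v, 'x) open_parity_game_scheme"
  assumes fin: "finite E" and tot: "Range E \<subseteq> Domain E"
    and X: "exits A \<subseteq> Domain E" "\<And>x y. x \<in> exits A \<Longrightarrow> (x, y) \<in> E \<Longrightarrow> y = x"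
    and i: "i \<in> Domain E" "i \<notin> exits A"
    and reach: "\<And>t. (\<And>x. x \<in> Domain E \<Longrightarrow> (x, t x) \<in> E) \<Longrightarrow>
      \<exists>p. p 0 = i \<and> path E p \<and> (\<forall>k. p k \<notin> U \<longrightarrow> p (Suc k) = t (p k)) \<and>
        good r (denotation A p) = b"
  obtains f where "\<And>x. x \<in> Domain E \<Longrightarrow> (x, f x) \<in> E"
    and "\<And>p. p 0 = i \<Longrightarrow> path E p \<Longrightarrow> (\<And>k. p k \<in> U \<Longrightarrow> p (Suc k) = f (p k)) \<Longrightarrow>
      good r (denotation A p) = b"
proof -
  define L where "L = loop_edges (exits A) i E"
  have dom: "Domain L = Domain E" using X(1) by (auto simp: L_def loop_edges_def)
  have fe: "finite (exits A)" unfolding exits_def by simp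
  have "L \<subseteq> E \<union> exits A \<times> {i}" by (auto simp: L_def loop_edges_def)
  then have finL: "finite L" by (rule finite_subset) (simp add: fin fe)
  have totL: "Range L \<subseteq> Domain L"
    unfolding dom using tot i by (auto simp: L_def loop_edges_def)
  have loop: "\<exists>f. (\<forall>x\<in>Domain E. (x, f x) \<in> E) \<and>
      (\<forall>p. p 0 = i \<longrightarrow> path E p \<longrightarrow> (\<forall>k. p k \<in> U' \<longrightarrow> p (Suc k) = f (p k)) \<longrightarrow>
        good r (denotation A p) = b')"
    if pw: "pos_wins (loop_prio A r) U' b' L i" for U' b'
  proof -
    obtain F where F: "restricts U' L F"
      and win: "\<And>q. q 0 = i \<Longrightarrow> path F q \<Longrightarrow> limsup_even (loop_prio A r) q = b'"
      using pw unfolding pos_wins_def by blast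
    \<comment> \<open>At an exit \<open>F\<close> holds the return edge, which is foreign to the
      open game; there \<open>f\<close> takes the loop at the exit instead.\<close>
    define f where "f x = (if x \<in> exits A then x else SOME y. (x, y) \<in> F)" for x
    have domF: "Domain F = Domain E" and FL: "F \<subseteq> L"
      using F dom unfolding restricts_def by auto
    have some: "(x, f x) \<in> F" if "x \<in> Domain E" "x \<notin> exits A" for x
      using that domF by (auto simp: f_def intro: someI)
    \<comment> \<open>The return edge is the only edge of \<open>L\<close> at an exit, and
      \<open>F\<close> is total, so no player can discard it.\<close>
    have ret: "exits A \<times> {i} \<subseteq> F"
    proof
      fix e assume "e \<in> exits A \<times> {i}"
      then obtain x where x: "e = (x, i)" "x \<in> exits A" by blast
      then obtain y where "(x, y) \<in> F" using X(1) domF by blast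
      moreover have "y = i" using calculation FL x(2) by (auto simp: L_def loop_edges_def)
      ultimately show "e \<in> F" using x by simp
    qed
    have "(x, f x) \<in> E" if x: "x \<in> Domain E" for x
    proof (cases "x \<in> exits A")
      case True
      then show ?thesis using x X(2) by (auto simp: f_def)
    next
      case False
      then have "(x, f x) \<in> L" using some[OF x] FL by blast
      then show ?thesis using False by (simp add: L_def loop_edges_def)
    qed
    moreover have "good r (denotation A p) = b'"
      if p: "p 0 = i" "path E p" "\<forall>k. p k \<in> U' \<longrightarrow> p (Suc k) = f (p k)" for p
    proof (rule good_denotation[where F=F and p=p, OF win ret i(2) p(1)])
      fix k assume k: "p k \<notin> exits A"
      have e: "(p k, p (Suc k)) \<in> E" using p(2) by (simp add: path_def)
      show "(p k, p (Suc k)) \<in> F"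
      proof (cases "p k \<in> U'")
        case True
        then show ?thesis using some[of "p k"] k e p(3) by auto
      next
        case False
        then show ?thesis using F e k unfolding restricts_def by (auto simp: L_def loop_edges_def)
      qed
    qed
    ultimately show ?thesis by blast
  qed
  have "\<not> pos_wins (loop_prio A r) (-U) (\<not> b) L i"
  proof
    assume "pos_wins (loop_prio A r) (-U) (\<not> b) L i"
    then obtain t where t: "\<And>x. x \<in> Domain E \<Longrightarrow> (x, t x) \<in> E"
      "\<And>p. p 0 = i \<Longrightarrow> path E p \<Longrightarrow> (\<forall>k. p k \<in> -U \<longrightarrow> p (Suc k) = t (p k)) \<Longrightarrow>
        good r (denotation A p) = (\<not> b)"
      using loop[of "-U" "\<not> b"] by blast
    obtain p where "p 0 = i" "path E p" "\<forall>k. p k \<notin> U \<longrightarrow> p (Suc k) = t (p k)"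
      "good r (denotation A p) = b"
      using reach[OF t(1)] by blast
    then show False using t(2)[of p] by simp
  qed
  then have "pos_wins (loop_prio A r) U b L i"
    using positional_determinacy[OF finL totL, of i "loop_prio A r" U b] dom i(1) by simp
  then obtain f where "\<forall>x\<in>Domain E. (x, f x) \<in> E"
    "\<forall>p. p 0 = i \<longrightarrow> path E p \<longrightarrow> (\<forall>k. p k \<in> U \<longrightarrow> p (Suc k) = f (p k)) \<longrightarrow>
        good r (denotation A p) = b"
    using loop by blast
  then show thesis by (intro that[of f]) blast+
qed

section \<open>The domain order and return priorities for upward closed sets\<close>

lemma dom_le_refl: "dom_le d d"
  by (cases d) (auto simp: dom_le_def sub_prio_le_def)

lemma dom_le_trans: "dom_le d d' \<Longrightarrow> dom_le d' d'' \<Longrightarrow> dom_le d d''"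
  by (auto simp: dom_le_def sub_prio_le_def)

lemma inj_sub_prio_key: "sub_prio_key m = sub_prio_key n \<Longrightarrow> m = n"
  by (auto simp: sub_prio_key_def split: if_splits)

lemma dom_le_antisym: "dom_le d d' \<Longrightarrow> dom_le d' d \<Longrightarrow> d = d'"
  by (auto simp: dom_le_def sub_prio_le_def intro!: inj_sub_prio_key)

text \<open>Let \<open>k\<close> be the least priority in \<open>K\<close>. If \<open>k\<close> is
  even, \<open>K\<close> holds the even priorities from \<open>k\<close> on, and the odd reply
  \<open>k - 1\<close> spoils the smaller ones. If \<open>k\<close> is odd, \<open>K\<close> holds
  all even priorities and the odd ones up to \<open>k\<close>, which the even reply
  \<open>k + 1\<close> rescues. The reply may exceed \<open>M\<close>, since determinacy allows
  arbitrary natural priorities.\<close>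

lemma response_exists:
  assumes up: "\<And>m n. m \<in> K \<Longrightarrow> sub_prio_le m n \<Longrightarrow> n \<in> K"
  shows "\<exists>r. \<forall>m\<le>M. even (max m r) \<longleftrightarrow> m \<in> K"
proof (cases "K \<inter> {..M} = {}")
  case True
  \<comment> \<open>An odd reply above all priorities makes every maximum odd.\<close>
  then show ?thesis by (intro exI[of _ "2 * M + 1"]) (auto simp: max_def)
next
  case False
  define k where "k = arg_min_on sub_prio_key (K \<inter> {..M})"
  have k: "k \<in> K" "\<And>m. m \<in> K \<Longrightarrow> m \<le> M \<Longrightarrow> sub_prio_key k \<le> sub_prio_key m"
    using arg_min_if_finite(1)[OF _ False, of sub_prio_key]
      arg_min_least[OF _ False, of _ sub_prio_key] by (auto simp: k_def)
  then have K: "m \<in> K \<longleftrightarrow> sub_prio_key k \<le> sub_prio_key m" if "m \<le> M" for m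
    using up that unfolding sub_prio_le_def by blast
  \<comment> \<open>For \<open>k = 0\<close> the truncated \<open>k - 1 = 0\<close> is the right response, too.\<close>
  define r where "r = (if even k then k - 1 else k + 1)"
  have "even (max m r) \<longleftrightarrow> sub_prio_key k \<le> sub_prio_key m" for m
  proof (cases "even k")
    case True
    then obtain l where l: "k = 2 * l" by (rule evenE)
    show ?thesis
    proof (cases "even m")
      case True
      then obtain n where "m = 2 * n" by (rule evenE)
      then show ?thesis using l by (cases l) (auto simp: r_def sub_prio_key_def max_def)
    next
      case False
      then obtain n where "m = 2 * n + 1" by (rule oddE)
      then show ?thesis using l by (cases l) (auto simp: r_def sub_prio_key_def max_def)
    qed
  next
    case False
    then obtain l where l: "k = 2 * l + 1" by (rule oddE)
    show ?thesis
    proof (cases "even m")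
      case True
      then show ?thesis using l by (auto simp: r_def sub_prio_key_def max_def)
    next
      case False
      then obtain n where "m = 2 * n + 1" by (rule oddE)
      then show ?thesis using l by (auto simp: r_def sub_prio_key_def max_def)
    qed
  qed
  then show ?thesis using K by blast
qed

text \<open>Values at different exits are incomparable, so \<open>Q\<close> splits into one upward
  closed set of priorities per exit, each with its own reply.\<close>

lemma good_exists:
  assumes up: "\<And>d d'. Q d \<Longrightarrow> dom_le d d' \<Longrightarrow> Q d'" and "Q Top" "\<not> Q Bot"
  obtains r where "good r Bot = Q Bot" "good r Top = Q Top"
    "\<And>x m. m \<le> M \<Longrightarrow> good r (Exit x m) = Q (Exit x m)"
proof -
  have "\<exists>r. \<forall>m\<le>M. even (max m r) \<longleftrightarrow> m \<in> {m. Q (Exit x m)}" for x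
    using up by (intro response_exists) (auto simp: dom_le_def)
  then obtain r where "\<And>x m. m \<le> M \<Longrightarrow> even (max m (r x)) \<longleftrightarrow> Q (Exit x m)"
    by (metis mem_Collect_eq)
  then show thesis using assms(2,3) by (intro that[of r]) auto
qed

definition dom_carrier :: "nat \<Rightarrow> 'v set \<Rightarrow> 'v dom set" where
  "dom_carrier M X = {Bot, Top} \<union> (\<lambda>(x, m). Exit x m) ` (X \<times> {..M})"

lemma denotation_in_dom_carrier:
  assumes "path (edges A) p" "prio A ` edges A \<subseteq> {0..M}" "p 0 \<notin> exits A"
  shows "denotation A p \<in> dom_carrier M (exits A)"
proof (cases "\<exists>j. p j \<in> exits A")
  case False
  then show ?thesis by (auto simp: denotation_def dom_carrier_def)
next
  case True
  then obtain n where n: "p n \<in> exits A"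
    "denotation A p = Exit (p n) (Max ((\<lambda>k. prio A (p k, p (Suc k))) ` {..<n}))"
    using denotation_Exit by blast
  have "n > 0" using n(1) assms(3) by (cases n) auto
  moreover have "prio A (p k, p (Suc k)) \<le> M" for k
    using assms(1,2) unfolding path_def by force
  ultimately have "Max ((\<lambda>k. prio A (p k, p (Suc k))) ` {..<n}) \<le> M"
    by (subst Max_le_iff) auto
  then show ?thesis using n by (auto simp: dom_carrier_def)
qed

lemma open_parity_gameD:
  assumes "open_parity_game M A"
  shows "finite (edges A)" "Domain (edges A) = nodes A" "Range (edges A) \<subseteq> nodes A"
    "ex_nodes A \<union> all_nodes A = nodes A" "ex_nodes A \<inter> all_nodes A = {}"
    "prio A ` edges A \<subseteq> {0..M}" "exits A \<subseteq> nodes A"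
    "\<And>x y. x \<in> exits A \<Longrightarrow> (x, y) \<in> edges A \<Longrightarrow> y = x"
    "\<And>i. i \<in> entrances A \<Longrightarrow> i \<in> nodes A \<and> i \<notin> exits A"
proof -
  have G: "parity_game M A" using assms by (simp add: open_parity_game_def)
  then show "finite (edges A)"
    unfolding parity_game_def by (meson finite_SigmaI finite_subset)
  show "Domain (edges A) = nodes A" "Range (edges A) \<subseteq> nodes A"
    "ex_nodes A \<union> all_nodes A = nodes A" "ex_nodes A \<inter> all_nodes A = {}"
    "prio A ` edges A \<subseteq> {0..M}"
    using G unfolding parity_game_def by auto
  show "exits A \<subseteq> nodes A" "\<And>x y. x \<in> exits A \<Longrightarrow> (x, y) \<in> edges A \<Longrightarrow> y = x"
    "\<And>i. i \<in> entrances A \<Longrightarrow> i \<in> nodes A \<and> i \<notin> exits A"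
    using assms G unfolding open_parity_game_def parity_game_def
    by (auto simp: entrances_def exits_def)
qed

text \<open>The edge set \<open>E\<close> is a parameter so that the same statement serves \<exists>
  in the whole game and \<forall> in the graph left by a positional \<exists>-strategy.\<close>

lemma positional_monotone:
  assumes A: "open_parity_game M A" and E: "E \<subseteq> edges A" "Domain E = nodes A"
    and i: "i \<in> entrances A"
    and up: "\<And>d d'. Q d \<Longrightarrow> dom_le d d' \<Longrightarrow> Q d'"
    and reach: "\<And>t. (\<And>x. x \<in> nodes A \<Longrightarrow> (x, t x) \<in> E) \<Longrightarrow>
      \<exists>p. p 0 = i \<and> path E p \<and> (\<forall>k. p k \<notin> U \<longrightarrow> p (Suc k) = t (p k)) \<and>
        Q (denotation A p) = b"
  obtains f where "\<And>x. x \<in> nodes A \<Longrightarrow> (x, f x) \<in> E"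
    and "\<And>p. p 0 = i \<Longrightarrow> path E p \<Longrightarrow> (\<And>k. p k \<in> U \<Longrightarrow> p (Suc k) = f (p k)) \<Longrightarrow>
      Q (denotation A p) = b"
proof (cases "Q Top \<and> \<not> Q Bot")
  \<comment> \<open>Here \<open>Q\<close> is constant, being upward closed with \<open>Bot\<close>
    least and \<open>Top\<close> greatest, and one use of \<open>reach\<close> shows that its value
    is \<open>b\<close>.\<close>
  case False
  have "dom_le Bot d" "dom_le d Top" for d :: "'a dom"
    by (simp_all add: dom_le_def)
  then have const: "Q d = Q d'" for d d'
    using False up by metis
  have "\<forall>x\<in>nodes A. \<exists>y. (x, y) \<in> E" using E(2) by blast
  then obtain f where "\<And>x. x \<in> nodes A \<Longrightarrow> (x, f x) \<in> E" by metis
  then show ?thesis using reach[of f] const by (intro that[of f]) blast+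
next
  case True
  note A' = open_parity_gameD[OF A]
  obtain r where r: "good r Bot = Q Bot" "good r Top = Q Top"
    "\<And>x m. m \<le> M \<Longrightarrow> good r (Exit x m) = Q (Exit x m)"
    using good_exists[of Q M] up True by blast
  have eq: "good r (denotation A p) = Q (denotation A p)" if "p 0 = i" "path E p" for p
  proof -
    have "denotation A p \<in> dom_carrier M (exits A)"
      using denotation_in_dom_carrier[OF path_mono[OF that(2) E(1)] A'(6)] that(1) A'(9)[OF i]
      by simp
    then show ?thesis using r by (auto simp: dom_carrier_def)
  qed
  have fin: "finite E" using E(1) A'(1) by (rule finite_subset)
  have tot: "Range E \<subseteq> Domain E" using E A'(3) by auto
  show ?thesis
  proof (rule positional_good[OF fin tot, where A=A and i=i and U=U and r=r and b=b])
    show "exits A \<subseteq> Domain E" "i \<in> Domain E" "i \<notin> exits A"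
      using A'(7) A'(9)[OF i] E(2) by auto
    show "y = x" if "x \<in> exits A" "(x, y) \<in> E" for x y
      using that A'(8) E(1) by blast
    show "\<exists>p. p 0 = i \<and> path E p \<and> (\<forall>k. p k \<notin> U \<longrightarrow> p (Suc k) = t (p k)) \<and>
        good r (denotation A p) = b" if "\<And>x. x \<in> Domain E \<Longrightarrow> (x, t x) \<in> E" for t
      using reach[of t] that eq E(2) by metis
  next
    fix f assume "\<And>x. x \<in> Domain E \<Longrightarrow> (x, f x) \<in> E"
      and "\<And>p. p 0 = i \<Longrightarrow> path E p \<Longrightarrow> (\<And>k. p k \<in> U \<Longrightarrow> p (Suc k) = f (p k)) \<Longrightarrow>
        good r (denotation A p) = b"
    then show thesis using eq E(2) by (intro that[of f]) auto
  qed
qed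

section \<open>Pareto fronts\<close>

lemma play_path:
  assumes A: "open_parity_game M A" and s: "ex_strategy A s" and t: "all_strategy A t"
    and i: "i \<in> nodes A"
  shows "path (edges A) (play A s t i)" and "play A s t i k \<in> nodes A"
proof -
  note A' = open_parity_gameD[OF A]
  let ?p = "play A s t i"
  \<comment> \<open>A strategy promises an edge only for histories inside \<open>nodes A\<close>,
    hence the assumption on the whole prefix.\<close>
  have step: "(?p k, ?p (Suc k)) \<in> edges A" if "\<forall>j\<le>k. ?p j \<in> nodes A" for k
  proof -
    have "map ?p [0..<k] \<in> lists (nodes A)" using that by auto
    moreover have "?p k \<in> ex_nodes A \<or> ?p k \<notin> ex_nodes A \<and> ?p k \<in> all_nodes A"
      using that A'(4) by blast
    ultimately show ?thesis
      using s t unfolding strategy_def play_Suc by auto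
  qed
  have "\<forall>j\<le>k. ?p j \<in> nodes A" for k
  proof (induction k)
    case (Suc k)
    then have "?p (Suc k) \<in> nodes A" using step[of k] A'(3) by blast
    with Suc show ?case by (auto simp: le_Suc_eq)
  qed (simp add: play_0 i)
  then show "path (edges A) ?p" "?p k \<in> nodes A" using step by (auto simp: path_def)
qed

lemma strategy_last:
  assumes "\<And>x. x \<in> U \<Longrightarrow> (x, f x) \<in> edges G"
  shows "strategy G U (\<lambda>h. f (last h))" "positional G U (\<lambda>h. f (last h))"
  using assms by (auto simp: strategy_def positional_def)

text \<open>The objective is the upward closure of the denotations that \<open>s\<close> admits, so
  \<open>s\<close> itself supplies the path against each positional opponent. Meeting this objective
  is what \<open>upper_le\<close> says.\<close>

lemma positional_improvement:
  assumes A: "open_parity_game M A" and i: "i \<in> entrances A" and s: "ex_strategy A s"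
  obtains s' where "positional_ex_strategy A s'"
    and "upper_le {denotation A (play A s t i) | t. all_strategy A t}
      {denotation A (play A s' t i) | t. all_strategy A t}"
proof -
  note A' = open_parity_gameD[OF A]
  let ?S = "{denotation A (play A s t i) | t. all_strategy A t}"
  let ?Q = "\<lambda>d'. \<exists>d\<in>?S. dom_le d d'"
  have "i \<in> nodes A" using A'(9) i by blast
  show thesis
  proof (rule positional_monotone[OF A subset_refl A'(2) i,
        where Q="?Q" and U="ex_nodes A" and b=True])
    show "?Q d'" if "?Q d" "dom_le d d'" for d d' using that dom_le_trans by blast
    show "\<exists>p. p 0 = i \<and> path (edges A) p \<and> (\<forall>k. p k \<notin> ex_nodes A \<longrightarrow> p (Suc k) = t (p k)) \<and>
        ?Q (denotation A p) = True" if "\<And>x. x \<in> nodes A \<Longrightarrow> (x, t x) \<in> edges A" for t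
    proof -
      let ?t = "\<lambda>h. t (last h)"
      have t: "all_strategy A ?t" using that A'(4) by (intro strategy_last) auto
      let ?p = "play A s ?t i"
      have "?Q (denotation A ?p)" using t dom_le_refl by blast
      moreover have "?p k \<notin> ex_nodes A \<longrightarrow> ?p (Suc k) = t (?p k)" for k
        by (simp add: play_Suc)
      ultimately show ?thesis
        using play_path(1)[OF A s t \<open>i \<in> nodes A\<close>] by (intro exI[of _ ?p]) (simp add: play_0)
    qed
  next
    fix f assume f: "\<And>x. x \<in> nodes A \<Longrightarrow> (x, f x) \<in> edges A"
      and win: "\<And>p. p 0 = i \<Longrightarrow> path (edges A) p \<Longrightarrow>
        (\<And>k. p k \<in> ex_nodes A \<Longrightarrow> p (Suc k) = f (p k)) \<Longrightarrow> ?Q (denotation A p) = True"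
    let ?s = "\<lambda>h. f (last h)"
    have s': "positional_ex_strategy A ?s" using f A'(4) strategy_last[of "ex_nodes A" f A] by auto
    have "?Q (denotation A (play A ?s t i))" if "all_strategy A t" for t
    proof -
      have "?Q (denotation A (play A ?s t i)) = True"
        using play_path(1)[OF A _ that \<open>i \<in> nodes A\<close>] s'
        by (intro win) (auto simp: play_0 play_Suc)
      then show ?thesis by (rule eqTrueE)
    qed
    then have "upper_le ?S {denotation A (play A ?s t i) | t. all_strategy A t}"
      unfolding upper_le_def by blast
    with s' show thesis by (rule that)
  qed
qed

text \<open>\<forall> aims at the denotations below that of the given play. Their complement is
  upward closed, which is why the outcome wanted is \<open>False\<close>. The given play is the path
  demanded by \<open>reach\<close>.\<close>

lemma positional_response:
  assumes A: "open_parity_game M A" and i: "i \<in> entrances A"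
    and s: "positional_ex_strategy A s" and t: "all_strategy A t"
  obtains t' where "positional_all_strategy A t'"
    and "dom_le (denotation A (play A s t' i)) (denotation A (play A s t i))"
proof -
  note A' = open_parity_gameD[OF A]
  \<comment> \<open>Since \<open>s\<close> is positional, its value on the history
    \<open>[x]\<close> is its value on every history ending in \<open>x\<close>.\<close>
  define E where "E = {(x, y) \<in> edges A. x \<in> ex_nodes A \<longrightarrow> y = s [x]}"
  define d where "d = denotation A (play A s t i)"
  have "i \<in> nodes A" using A'(9) i by blast
  have "x \<in> Domain E" if "x \<in> nodes A" for x
  proof (cases "x \<in> ex_nodes A")
    case True
    then have "(x, s ([] @ [x])) \<in> edges A" using s unfolding strategy_def by blast
    then show ?thesis by (auto simp: E_def)
  next
    case False
    then show ?thesis using that A'(2) by (auto simp: E_def)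
  qed
  then have E: "E \<subseteq> edges A" "Domain E = nodes A" using A'(2) by (auto simp: E_def)
  have pathE: "path E (play A s t' i)" if "all_strategy A t'" for t'
    unfolding path_def
  proof
    fix k
    let ?p = "play A s t' i"
    note P = play_path[OF A conjunct1[OF s] that \<open>i \<in> nodes A\<close>]
    have "?p (Suc k) = s [?p k]" if "?p k \<in> ex_nodes A"
    proof -
      have "map ?p [0..<k] \<in> lists (nodes A)" using P(2) by auto
      then have "s (map ?p [0..<k] @ [?p k]) = s ([] @ [?p k])"
        using conjunct2[OF s] that unfolding positional_def by blast
      then show ?thesis using that by (simp add: play_Suc)
    qed
    then show "(?p k, ?p (Suc k)) \<in> E" using P(1) by (auto simp: E_def path_def)
  qed
  show thesis
  proof (rule positional_monotone[OF A E i,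
        where Q="\<lambda>d'. \<not> dom_le d' d" and U="all_nodes A" and b=False])
    show "\<not> dom_le d2 d" if "\<not> dom_le d1 d" "dom_le d1 d2" for d1 d2
      using that dom_le_trans by blast
    show "\<exists>p. p 0 = i \<and> path E p \<and> (\<forall>k. p k \<notin> all_nodes A \<longrightarrow> p (Suc k) = f (p k)) \<and>
        (\<not> dom_le (denotation A p) d) = False" if "\<And>x. x \<in> nodes A \<Longrightarrow> (x, f x) \<in> E" for f
    proof (intro exI[of _ "play A s t i"] conjI allI impI)
      fix k assume "play A s t i k \<notin> all_nodes A"
      let ?p = "play A s t i"
      have n: "?p k \<in> nodes A" by (rule play_path(2)[OF A conjunct1[OF s] t \<open>i \<in> nodes A\<close>])
      then have "?p k \<in> ex_nodes A" using A'(4) \<open>?p k \<notin> all_nodes A\<close> by blast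
      moreover have "(?p k, ?p (Suc k)) \<in> E" using pathE[OF t] by (simp add: path_def)
      \<comment> \<open>At \<exists>-nodes \<open>E\<close> has a single edge, so every
        \<open>f\<close> inside \<open>E\<close> agrees there with \<open>s\<close>.\<close>
      ultimately show "?p (Suc k) = f (?p k)" using that[OF n] by (simp add: E_def)
    qed (use pathE[OF t] dom_le_refl in \<open>auto simp: play_0 d_def\<close>)
  next
    fix f assume f: "\<And>x. x \<in> nodes A \<Longrightarrow> (x, f x) \<in> E"
      and win: "\<And>p. p 0 = i \<Longrightarrow> path E p \<Longrightarrow>
        (\<And>k. p k \<in> all_nodes A \<Longrightarrow> p (Suc k) = f (p k)) \<Longrightarrow> (\<not> dom_le (denotation A p) d) = False"
    let ?t = "\<lambda>h. f (last h)"
    have t': "positional_all_strategy A ?t"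
      using f A'(4) E(1) strategy_last[of "all_nodes A" f A] by blast
    have "(\<not> dom_le (denotation A (play A s ?t i)) d) = False"
      using pathE t' A'(5) by (intro win) (auto simp: play_0 play_Suc)
    then have "dom_le (denotation A (play A s ?t i)) (denotation A (play A s t i))"
      by (simp add: d_def)
    with t' show thesis by (rule that)
  qed
qed

section \<open>Minimal elements, the upper preorder and maximal sets\<close>

lemma ex_minimal:
  assumes "finite T" "d \<in> T"
  obtains d' where "d' \<in> minimals T" "dom_le d' d"
proof -
  \<comment> \<open>An element below \<open>d\<close> with the smallest down-set is minimal:
    anything strictly below it would have a smaller one.\<close>
  let ?down = "\<lambda>d. {e \<in> T. dom_le e d}"
  obtain d' where d': "d' \<in> T" "dom_le d' d"
    and least: "\<And>e. e \<in> T \<Longrightarrow> dom_le e d \<Longrightarrow> card (?down d') \<le> card (?down e)"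
    using ex_has_least_nat[of "\<lambda>e. e \<in> T \<and> dom_le e d" d "\<lambda>e. card (?down e)"]
      assms(2) dom_le_refl by blast
  have "dom_le d' e" if e: "e \<in> T" "dom_le e d'" for e
  proof (rule ccontr)
    assume "\<not> dom_le d' e"
    then have "?down e \<subset> ?down d'" using d' e dom_le_trans dom_le_refl by blast
    then have "card (?down e) < card (?down d')"
      using assms(1) by (intro psubset_card_mono) auto
    moreover have "card (?down d') \<le> card (?down e)"
      using least e d' dom_le_trans by blast
    ultimately show False by simp
  qed
  then show thesis using d' that unfolding minimals_def by blast
qed

lemma upper_le_minimals:
  assumes "upper_le T T'" "finite T"
  shows "upper_le (minimals T) (minimals T')"
  unfolding upper_le_def
proof
  fix d' assume "d' \<in> minimals T'"
  then obtain d where d: "d \<in> T" "dom_le d d'"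
    using assms(1) unfolding upper_le_def minimals_def by blast
  obtain e where "e \<in> minimals T" "dom_le e d" using ex_minimal[OF assms(2) d(1)] .
  then show "\<exists>d\<in>minimals T. dom_le d d'" using d(2) dom_le_trans by blast
qed

text \<open>Descending from \<open>d\<close> to the other set and back ends at a minimal element of
  \<open>T\<close> below \<open>d\<close>. By minimality this is \<open>d\<close> again, and the
  element in between is squeezed to \<open>d\<close> as well.\<close>

lemma upper_le_minimals_subset:
  assumes "upper_le (minimals T) (minimals T')" "upper_le (minimals T') (minimals T)"
  shows "minimals T \<subseteq> minimals T'"
proof
  fix d assume d: "d \<in> minimals T"
  obtain d' where d': "d' \<in> minimals T'" "dom_le d' d"
    using assms(2) d unfolding upper_le_def by blast
  obtain e where e: "e \<in> minimals T" "dom_le e d'"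
    using assms(1) d'(1) unfolding upper_le_def by blast
  have "dom_le d e"
    using d e dom_le_trans[OF e(2) d'(2)] unfolding minimals_def by blast
  then have "d = d'"
    using d'(2) e(2) dom_le_trans dom_le_antisym by blast
  then show "d \<in> minimals T'" using d' by simp
qed

lemma upper_le_minimals_antisym:
  "upper_le (minimals T) (minimals T') \<Longrightarrow> upper_le (minimals T') (minimals T) \<Longrightarrow>
    minimals T = minimals T'"
  by (simp add: subset_antisym upper_le_minimals_subset)

lemma minimals_coinitial:
  assumes "T' \<subseteq> T" "upper_le T' T"
  shows "minimals T = minimals T'"
proof
  show "minimals T \<subseteq> minimals T'"
  proof
    fix d assume d: "d \<in> minimals T"
    obtain d' where d': "d' \<in> T'" "dom_le d' d"
      using assms(2) d unfolding upper_le_def minimals_def by blast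
    then have "d = d'"
      using d assms(1) dom_le_antisym unfolding minimals_def by blast
    then show "d \<in> minimals T'" using d d' assms(1) unfolding minimals_def by blast
  qed
  show "minimals T' \<subseteq> minimals T"
  proof
    fix d assume d: "d \<in> minimals T'"
    have "dom_le d e" if e: "e \<in> T" "dom_le e d" for e
    proof -
      obtain e' where "e' \<in> T'" "dom_le e' e" using assms(2) e unfolding upper_le_def by blast
      then show ?thesis using d e(2) dom_le_trans unfolding minimals_def by blast
    qed
    then show "d \<in> minimals T" using d assms(1) unfolding minimals_def by blast
  qed
qed

text \<open>Cofinality makes a maximal \<open>T\<close> equivalent to a member of \<open>S'\<close>;
  antisymmetry upgrades this to equality, so that the two families coincide as sets.\<close>

lemma maximals_cofinal:
  assumes "S' \<subseteq> S" "\<And>T. T \<in> S \<Longrightarrow> \<exists>T'\<in>S'. upper_le T T'"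
    and antisym: "\<And>T T'. T \<in> S \<Longrightarrow> T' \<in> S \<Longrightarrow> upper_le T T' \<Longrightarrow> upper_le T' T \<Longrightarrow> T = T'"
  shows "maximals S = maximals S'"
proof
  show "maximals S \<subseteq> maximals S'"
  proof
    fix T assume T: "T \<in> maximals S"
    then obtain T' where T': "T' \<in> S'" "upper_le T T'"
      using assms(2) unfolding maximals_def by blast
    then have "T = T'" using T assms(1) antisym unfolding maximals_def by blast
    then show "T \<in> maximals S'" using T T' assms(1) unfolding maximals_def by blast
  qed
  have trans: "upper_le T T''" if "upper_le T T'" "upper_le T' T''" for T T' T''
    using that dom_le_trans unfolding upper_le_def by meson
  show "maximals S' \<subseteq> maximals S"
  proof
    fix T assume T: "T \<in> maximals S'"
    have "upper_le R T" if R: "R \<in> S" "upper_le T R" for R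
    proof -
      obtain R' where "R' \<in> S'" "upper_le R R'" using assms(2) R by blast
      then show ?thesis using T R(2) trans unfolding maximals_def by blast
    qed
    then show "T \<in> maximals S" using T assms(1) unfolding maximals_def by blast
  qed
qed

theorem theorem4p1:
  fixes A :: "'v open_parity_game" and M :: nat and i :: 'v
  assumes "even M" and "M \<ge> 2"
    and "open_parity_game M A"
    and "i \<in> entrances A"
  shows "pareto_front A i =
    maximals {minimals {denotation A (play A \<sigma>\<^sub>E \<sigma>\<^sub>A i) | \<sigma>\<^sub>A. positional_all_strategy A \<sigma>\<^sub>A}
      | \<sigma>\<^sub>E. positional_ex_strategy A \<sigma>\<^sub>E}"
proof -
  note A = assms(3) and i = assms(4)
  note A' = open_parity_gameD[OF A]
  define D where "D s = {denotation A (play A s t i) | t. all_strategy A t}" for s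
  define P where "P s = {denotation A (play A s t i) | t. positional_all_strategy A t}" for s
  have fin: "finite (D s)" if "ex_strategy A s" for s
  proof (rule finite_subset)
    have "denotation A (play A s t i) \<in> dom_carrier M (exits A)" if t: "all_strategy A t" for t
      using play_path(1)[OF A \<open>ex_strategy A s\<close> t] A'(6) A'(9)[OF i]
      by (intro denotation_in_dom_carrier) (simp_all add: play_0)
    then show "D s \<subseteq> dom_carrier M (exits A)" unfolding D_def by blast
    show "finite (dom_carrier M (exits A))" by (simp add: dom_carrier_def exits_def)
  qed
  \<comment> \<open>\<open>positional_response\<close> requires a positional \<open>s\<close>. The
    \<exists>-side is therefore thinned out with \<forall> still ranging over all strategies, that
    is, in terms of \<open>D\<close>.\<close>
  have "minimals (D s) = minimals (P s)" if s: "positional_ex_strategy A s" for s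
  proof (rule minimals_coinitial)
    show "upper_le (P s) (D s)"
      unfolding upper_le_def D_def P_def using positional_response[OF A i s] by blast
  qed (auto simp: D_def P_def)
  then have "{minimals (P s) | s. positional_ex_strategy A s} =
      {minimals (D s) | s. positional_ex_strategy A s}" by metis
  moreover have "pareto_front A i = maximals {minimals (D s) | s. positional_ex_strategy A s}"
    unfolding pareto_front_def D_def[symmetric]
  proof (rule maximals_cofinal)
    fix T assume "T \<in> {minimals (D s) | s. ex_strategy A s}"
    then obtain s where s: "T = minimals (D s)" "ex_strategy A s" by blast
    obtain s' where "positional_ex_strategy A s'" "upper_le (D s) (D s')"
      using positional_improvement[OF A i s(2)] unfolding D_def .
    then show "\<exists>T'\<in>{minimals (D s) | s. positional_ex_strategy A s}. upper_le T T'"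
      using upper_le_minimals fin s by blast
  qed (use upper_le_minimals_antisym in blast)+
  ultimately show ?thesis unfolding P_def by simp
qed

end
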